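(* Let $G$ be a nontrivial cyclic group of order $n$, let $S$ be the set of all generators of $G$, and let $\Gamma(G)$ be the generator graph of $G$. Then the Wiener index of $\Gamma(G)$ is $$W(\Gamma(G)) = \tfrac{1}{2}|S|^2 - \tfrac{1}{2}(2n-1)|S| + n^2 - n.$$
   Context: For a group $G$, the generator graph $\Gamma(G)$ is the simple undirected graph whose vertex set is the set of elements of $G$, in which two distinct elements $x,y$ are adjacent if and only if at least one of them generates $G$ (i.e. $\langle x\rangle = G$ or $\langle y\rangle = G$). For a connected graph $\Gamma$, the Wiener index is $W(\Gamma) = \sum_{\{u,v\}\subseteq V(\Gamma)} d_\Gamma(u,v)$, the sum over all unordered pairs of distinct vertices of their distance. *)

theory Defs
  imports
    "HOL-Algebra.Elementary_Groups"
    "Graph_Theory.Pair_Digraph"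
    "Graph_Theory.Shortest_Path"
begin

definition generators :: "('a, 'b) monoid_scheme \<Rightarrow> 'a set" where
  "generators G = {x \<in> carrier G. generate G {x} = carrier G}"

text \<open>
  Undirected simple graphs are represented, as in Graph_Theory, by symmetric loop-free
  digraphs: an edge between x and y is the pair of arcs (x, y) and (y, x).
\<close>

definition generator_graph :: "('a, 'b) monoid_scheme \<Rightarrow> 'a pair_pre_digraph" where
  "generator_graph G =
     \<lparr> pverts = carrier G,
       parcs = {(x, y). x \<in> carrier G \<and> y \<in> carrier G \<and> x \<noteq> y \<and>
                        (generate G {x} = carrier G \<or> generate G {y} = carrier G)} \<rparr>"

lemma generator_graph_bidirected: "pair_bidirected_digraph (generator_graph G)"
proof
  show "symmetric (with_proj (generator_graph G))"
    unfolding symmetric_def with_proj_simps generator_graph_def sym_def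
    by (simp add: conj_commute disj_commute) blast
  fix e
  assume "e \<in> parcs (generator_graph G)"
  then show "fst e \<in> pverts (generator_graph G)" "snd e \<in> pverts (generator_graph G)"
    "fst e \<noteq> snd e"
    by (simp_all add: generator_graph_def case_prod_beta)
qed

lemma generator_graph_pair_graph:
  assumes "finite (carrier G)"
  shows "pair_graph (generator_graph G)"
proof -
  interpret pair_bidirected_digraph "generator_graph G"
    by (rule generator_graph_bidirected)
  have "parcs (generator_graph G) \<subseteq> carrier G \<times> carrier G"
    unfolding generator_graph_def by (simp add: subset_iff)
  then have "finite (parcs (generator_graph G))"
    by (rule finite_subset) (simp add: assms)
  then show ?thesis
    using assms by unfold_locales (simp_all add: generator_graph_def)
qed

text \<open>
  The distance is the infimum of the lengths of all walks (every arc has weight 1);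
  it is \<open>\<infinity>\<close> if there is no walk.
\<close>

definition graph_dist :: "('a, 'b) pre_digraph \<Rightarrow> 'a \<Rightarrow> 'a \<Rightarrow> ereal" where
  "graph_dist \<Gamma> u v = wf_digraph.\<mu> \<Gamma> (\<lambda>_. 1) u v"

text \<open>
  The sum ranges over the two-element sets e of vertices; the description picks the common
  value of the distance for the two orderings of e, which is unique in a symmetric digraph.
  A finite value forces every distance to be finite, i.e. the graph to be connected.
  The definition is meant for graphs with finitely many vertices.
\<close>

definition wiener_index :: "('a, 'b) pre_digraph \<Rightarrow> ereal" where
  "wiener_index \<Gamma> =
     (\<Sum>e \<in> {e. e \<subseteq> verts \<Gamma> \<and> card e = 2}.
        THE d. \<exists>u v. e = {u, v} \<and> d = graph_dist \<Gamma> u v)"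

end

theory Submission
  imports Defs
begin

text \<open>
  Two distinct vertices are at distance 1 unless both are non-generators, in which case any
  generator is a common neighbour and their distance is 2. Hence the Wiener index counts every
  pair of vertices once and every pair of non-generators once more.
\<close>

text \<open>With constant weight 1 the cost of a walk is its number of arcs. In this form
  \<open>INF_eqI\<close> reduces a distance to a lower bound for all walks and one walk attaining
  it.\<close>

lemma (in wf_digraph) graph_dist_eq_INF_length:
  "graph_dist G u v = (INF p\<in>{p. awalk u p v}. ereal (real (length p)))"
  by (simp add: graph_dist_def \<mu>_def awalk_cost_def sum_list_triv)

text \<open>The empty walk joins a vertex only to itself, so every walk from \<open>u\<close> to
  \<open>v\<close> has an arc, and the given arc alone is such a walk.\<close>

lemma (in wf_digraph) graph_dist_adjacent:
  assumes "u \<rightarrow> v" "u \<noteq> v"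
  shows "graph_dist G u v = 1"
  unfolding graph_dist_eq_INF_length
proof (rule INF_eqI)
  fix p assume "p \<in> {p. awalk u p v}"
  then have "p \<noteq> []" using assms(2) by (auto simp: awalk_Nil_iff)
  then have "1 \<le> length p" by (cases p) auto
  then show "1 \<le> ereal (real (length p))" by simp
next
  fix y :: ereal
  assume y: "\<And>p. p \<in> {p. awalk u p v} \<Longrightarrow> y \<le> ereal (real (length p))"
  obtain e where "e \<in> arcs G" "tail G e = u" "head G e = v"
    using assms(1) by (auto simp: arcs_ends_def arc_to_ends_def)
  then have "awalk u [e] v" by (auto simp: awalk_def)
  with y[of "[e]"] show "y \<le> 1" by (simp add: one_ereal_def)
qed

text \<open>Length 0 would force \<open>u = v\<close> and length 1 would make \<open>u\<close> and
  \<open>v\<close> adjacent; the detour through \<open>w\<close> has length 2.\<close>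

lemma (in wf_digraph) graph_dist_common_neighbour:
  assumes "u \<rightarrow> w" "w \<rightarrow> v" "u \<noteq> v" "\<not> u \<rightarrow> v"
  shows "graph_dist G u v = 2"
  unfolding graph_dist_eq_INF_length
proof (rule INF_eqI)
  fix p assume "p \<in> {p. awalk u p v}"
  then have p: "awalk u p v" by simp
  have "2 \<le> length p"
  proof (rule ccontr)
    assume "\<not> 2 \<le> length p"
    then consider "p = []" | e where "p = [e]"
      by (cases p; cases "tl p") auto
    then show False
    proof cases
      case 1
      with p assms(3) show False by (simp add: awalk_Nil_iff)
    next
      case 2
      with p have "e \<in> arcs G" "tail G e = u" "head G e = v" by (auto simp: awalk_def)
      with assms(4) show False by (auto simp: arcs_ends_def arc_to_ends_def)
    qed
  qed
  then show "2 \<le> ereal (real (length p))" by simp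
next
  fix y :: ereal
  assume y: "\<And>p. p \<in> {p. awalk u p v} \<Longrightarrow> y \<le> ereal (real (length p))"
  obtain e where "e \<in> arcs G" "tail G e = u" "head G e = w"
    using assms(1) by (auto simp: arcs_ends_def arc_to_ends_def)
  moreover obtain f where "f \<in> arcs G" "tail G f = w" "head G f = v"
    using assms(2) by (auto simp: arcs_ends_def arc_to_ends_def)
  ultimately have "awalk u [e, f] v" by (auto simp: awalk_def)
  with y[of "[e, f]"] show "y \<le> 2" by simp
qed

lemma graph_dist_generator_graph:
  assumes "u \<in> carrier G" "v \<in> carrier G" "u \<noteq> v" "generators G \<noteq> {}"
  shows "graph_dist (with_proj (generator_graph G)) u v =
    (if {u, v} \<subseteq> carrier G - generators G then 2 else 1)"
proof -
  interpret pair_bidirected_digraph "generator_graph G"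
    by (rule generator_graph_bidirected)
  have wf: "wf_digraph (with_proj (generator_graph G))"
    by unfold_locales
  have arcs: "(x, y) \<in> parcs (generator_graph G) \<longleftrightarrow>
      x \<in> carrier G \<and> y \<in> carrier G \<and> x \<noteq> y \<and> (x \<in> generators G \<or> y \<in> generators G)" for x y
    by (auto simp: generator_graph_def generators_def)
  show ?thesis
  proof (cases "{u, v} \<subseteq> carrier G - generators G")
    case True
    \<comment> \<open>As \<open>u\<close> and \<open>v\<close> are non-generators, \<open>w\<close>
      differs from both, so neither arc is a loop.\<close>
    obtain w where "w \<in> generators G" using assms(4) by blast
    moreover from this have "w \<in> carrier G" by (simp add: generators_def)
    ultimately have "(u, w) \<in> parcs (generator_graph G)" "(w, v) \<in> parcs (generator_graph G)"
      "(u, v) \<notin> parcs (generator_graph G)"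
      using True by (auto simp: arcs)
    then have "graph_dist (with_proj (generator_graph G)) u v = 2"
      by (intro wf_digraph.graph_dist_common_neighbour[OF wf, of u w v])
        (use assms(3) in simp_all)
    with True show ?thesis by simp
  next
    case False
    then have "(u, v) \<in> parcs (generator_graph G)"
      using assms by (auto simp: arcs)
    then have "graph_dist (with_proj (generator_graph G)) u v = 1"
      by (intro wf_digraph.graph_dist_adjacent[OF wf]) (use assms(3) in simp_all)
    with False show ?thesis by simp
  qed
qed

lemma wiener_index_generator_graph:
  assumes "finite (carrier G)" "generators G \<noteq> {}"
  shows "wiener_index (with_proj (generator_graph G)) =
    ereal (real (card (carrier G) choose 2) + real (card (carrier G - generators G) choose 2))"
proof -
  define E where "E = {e. e \<subseteq> carrier G \<and> card e = 2}"
  let ?N = "carrier G - generators G"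
  have fin: "finite E" using assms(1) by (simp add: E_def)
  have "wiener_index (with_proj (generator_graph G)) =
      (\<Sum>e\<in>E. THE d. \<exists>u v. e = {u, v} \<and> d = graph_dist (with_proj (generator_graph G)) u v)"
    by (simp add: wiener_index_def E_def generator_graph_def)
  \<comment> \<open>Writing the distances 1 and 2 as 1 plus an indicator lets the sum split into two
    counts of pairs.\<close>
  also have "\<dots> = (\<Sum>e\<in>E. ereal (1 + (if e \<subseteq> ?N then 1 else 0)))"
  proof (rule sum.cong[OF refl])
    fix e assume "e \<in> E"
    then obtain u v where e: "e = {u, v}" "u \<noteq> v" "u \<in> carrier G" "v \<in> carrier G"
      by (auto simp: E_def card_2_iff)
    \<comment> \<open>The right-hand side depends on the set \<open>e\<close> only, so both
      orderings of \<open>e\<close> give the same value and the description is well defined.\<close>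
    have *: "d = graph_dist (with_proj (generator_graph G)) a b \<longleftrightarrow>
        d = ereal (1 + (if e \<subseteq> ?N then 1 else 0))" if "e = {a, b}" for a b d
    proof -
      have "a \<in> carrier G" "b \<in> carrier G" "a \<noteq> b"
        using e that by (auto simp: doubleton_eq_iff)
      then have "graph_dist (with_proj (generator_graph G)) a b = (if e \<subseteq> ?N then 2 else 1)"
        using graph_dist_generator_graph[of a G b] assms(2) that by simp
      then show ?thesis by (simp add: one_ereal_def)
    qed
    show "(THE d. \<exists>u v. e = {u, v} \<and> d = graph_dist (with_proj (generator_graph G)) u v) =
        ereal (1 + (if e \<subseteq> ?N then 1 else 0))"
      by (rule the_equality) (use * e(1) in blast)+
  qed
  \<comment> \<open>From here on the computation takes place in the reals.\<close>
  also have "\<dots> = ereal (\<Sum>e\<in>E. 1 + (if e \<subseteq> ?N then 1 else 0))"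
    by (rule sum_ereal)
  also have "(\<Sum>e\<in>E. 1 + (if e \<subseteq> ?N then 1 else 0)) = real (card E) + real (card {e \<in> E. e \<subseteq> ?N})"
    using fin by (simp add: sum.distrib sum.If_cases Int_def)
  also have "{e \<in> E. e \<subseteq> ?N} = {e. e \<subseteq> ?N \<and> card e = 2}"
    by (auto simp: E_def)
  also have "card E = card (carrier G) choose 2"
    unfolding E_def by (rule n_subsets[OF assms(1)])
  also have "card {e. e \<subseteq> ?N \<and> card e = 2} = card ?N choose 2"
    using assms(1) by (intro n_subsets) simp
  finally show ?thesis .
qed

text \<open>Comparing carriers turns the equality of groups in \<open>cyclic_group\<close> into the
  equality of sets in \<open>generators\<close>.\<close>

lemma (in group) generators_nonempty:
  assumes "cyclic_group G"
  shows "generators G \<noteq> {}"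
proof -
  obtain x where "x \<in> carrier G" "subgroup_generated G {x} = G"
    using assms by (auto simp: cyclic_group_def)
  then have "generate G {x} = carrier G"
    using carrier_subgroup_generated[of G "{x}"] by simp
  with \<open>x \<in> carrier G\<close> show ?thesis by (auto simp: generators_def)
qed

text \<open>Induction by Pascal's rule. Subtraction and division are real, so nothing is truncated,
  and at \<open>n = 0\<close> both sides vanish.\<close>

lemma real_choose_two: "real (n choose 2) = real n * (real n - 1) / 2"
  by (induction n) (simp_all add: numeral_2_eq_2 field_simps)

theorem theorem4p1:
  fixes G :: "('a, 'b) monoid_scheme" and n :: nat and S :: "'a set"
  assumes "group G" and "cyclic_group G" and "\<not> trivial_group G"
    and "finite (carrier G)" and "order G = n"
    and "S = generators G"
  shows "wiener_index (with_proj (generator_graph G)) =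
    ereal (1 / 2 * (real (card S))\<^sup>2 - 1 / 2 * (2 * real n - 1) * real (card S)
           + (real n)\<^sup>2 - real n)"
proof -
  have S: "S \<subseteq> carrier G" using assms(6) by (auto simp: generators_def)
  have n: "card (carrier G) = n" using assms(5) by (simp add: order_def)
  \<comment> \<open>The cast commutes with the subtraction because \<open>S\<close> lies in the
    finite carrier, so its cardinality is at most \<open>n\<close>.\<close>
  have "real (card (carrier G - S)) = real n - real (card S)"
    using S assms(4) n by (metis card_Diff_subset card_mono finite_subset of_nat_diff)
  \<comment> \<open>With s the cardinality of \<open>S\<close>, it remains to expand n(n - 1)/2 + (n
    - s)(n - s - 1)/2.\<close>
  then show ?thesis
    using wiener_index_generator_graph[OF assms(4) group.generators_nonempty[OF assms(1,2)]]
    by (simp add: real_choose_two n flip: assms(6)) (simp add: power2_eq_square field_simps)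
qed

end
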